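(* Let $g$ be a smooth complete Riemannian metric on $\mathbb R^3$ with $|g-g_{\mathrm{Euc}}|=o(|x|^{-1})$ as $|x|\to\infty$, let $X$ be as in the context, and for $\sigma>0$ and dyadic $R=2^N$ set $$P_R^\sigma=\frac1{4\pi}\int_{|x|\le\sigma R}X(x)\,dx .$$ For every fixed $\sigma>0$, along dyadic $R\to\infty$, $$|P_R^\sigma|=o(\log R).$$ Moreover, if $0<\sigma_1<\sigma_2<\infty$ are fixed, then along dyadic $R\to\infty$, $$P_R^{\sigma_2}-P_R^{\sigma_1}=o(1).$$
   Context: Unless a subscript $g$ appears, all operators, norms and balls are Euclidean in the standard coordinates of $\mathbb R^3$. Set $A=(a^{ij})$, $a^{ij}=\sqrt{\det(g_{kl})}\,g^{ij}$, $B=I-A$ (so $|B(x)|=o(|x|^{-1})$), $Lf=\operatorname{div}(A\nabla f)=\sqrt{\det(g_{kl})}\,\Delta_g f$. The function $u$ is the positive Green function of $L$ with pole at the origin (smooth and $L$-harmonic on $\mathbb R^3\setminus\{0\}$, $u\to\infty$ at $0$, $u\to0$ at infinity), normalized so that $\int_{\{u=s\}}|\nabla_g u|\,dA_g=4\pi$ for every regular value $s>0$ (i.e. $-Lu=4\pi\delta_0$); it satisfies $c_0/|x|\le u(x)\le C_0/|x|$ for $|x|\ge1$ with constants $0<c_0\le C_0$. $X$ is any fixed smooth vector field on $\mathbb R^3$ which agrees with $B\nabla u$ outside $B_{1/16}$. "Along dyadic $R\to\infty$" means $R=2^N$, $N\in\mathbb N$, $N\to\infty$. *)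

theory Defs
  imports "HOL-Analysis.Analysis" "HOL-Library.Landau_Symbols"
begin

section \<open>Calculus in the standard coordinates\<close>

text \<open>Only meant for open \<open>S\<close>, where the derivative within \<open>S\<close> is the full derivative.\<close>

primrec Ck_on :: "nat \<Rightarrow> 'a set \<Rightarrow> ('a::euclidean_space \<Rightarrow> 'b::real_normed_vector) \<Rightarrow> bool" where
  "Ck_on 0 S f \<longleftrightarrow> continuous_on S f"
| "Ck_on (Suc k) S f \<longleftrightarrow>
     f differentiable_on S \<and> (\<forall>b\<in>Basis. Ck_on k S (\<lambda>x. frechet_derivative f (at x) b))"

definition smooth_on :: "'a set \<Rightarrow> ('a::euclidean_space \<Rightarrow> 'b::real_normed_vector) \<Rightarrow> bool" where
  "smooth_on S f \<longleftrightarrow> (\<forall>k. Ck_on k S f)"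

definition partial :: "'n::finite \<Rightarrow> (real^'n \<Rightarrow> real) \<Rightarrow> real^'n \<Rightarrow> real" where
  "partial i f x = frechet_derivative f (at x) (axis i 1)"

definition grad :: "(real^'n::finite \<Rightarrow> real) \<Rightarrow> real^'n \<Rightarrow> real^'n" where
  "grad f x = (\<chi> i. partial i f x)"

definition divergence :: "(real^'n::finite \<Rightarrow> real^'n) \<Rightarrow> real^'n \<Rightarrow> real" where
  "divergence F x = (\<Sum>i\<in>UNIV. partial i (\<lambda>y. F y $ i) x)"

section \<open>Riemannian metrics on \<open>\<real>\<^sup>3\<close>\<close>

text \<open>A metric is given by its coordinate matrix \<open>(g\<^sub>i\<^sub>j(x))\<close>; the Euclidean metric is \<open>mat 1\<close>.\<close>

definition riemannian_metric :: "(real^3 \<Rightarrow> real^3^3) \<Rightarrow> bool" where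
  "riemannian_metric g \<longleftrightarrow>
     smooth_on UNIV g \<and>
     (\<forall>x. transpose (g x) = g x) \<and>
     (\<forall>x v. v \<noteq> 0 \<longrightarrow> v \<bullet> (g x *v v) > 0)"

definition g_norm :: "(real^3 \<Rightarrow> real^3^3) \<Rightarrow> real^3 \<Rightarrow> real^3 \<Rightarrow> real" where
  "g_norm g x v = sqrt (v \<bullet> (g x *v v))"

definition speed :: "(real^3 \<Rightarrow> real^3^3) \<Rightarrow> (real \<Rightarrow> real^3) \<Rightarrow> real \<Rightarrow> real" where
  "speed g \<gamma> t = g_norm g (\<gamma> t) (vector_derivative \<gamma> (at t))"

text \<open>
  \<open>valid_path\<close> allows the derivative to be unbounded near a break point. Curves of infinite
  length must be excluded explicitly, since \<open>integral\<close> would assign them length \<open>0\<close>.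
\<close>

definition g_dist :: "(real^3 \<Rightarrow> real^3^3) \<Rightarrow> real^3 \<Rightarrow> real^3 \<Rightarrow> real" where
  "g_dist g p q = Inf {integral {0..1} (speed g \<gamma>) | \<gamma>.
     valid_path \<gamma> \<and> speed g \<gamma> integrable_on {0..1} \<and> pathstart \<gamma> = p \<and> pathfinish \<gamma> = q}"

definition complete_metric :: "(real^3 \<Rightarrow> real^3^3) \<Rightarrow> bool" where
  "complete_metric g \<longleftrightarrow> Metric_space.mcomplete UNIV (g_dist g)"

definition ediam :: "('a \<Rightarrow> 'a \<Rightarrow> real) \<Rightarrow> 'a set \<Rightarrow> ennreal" where
  "ediam d U = (SUP x\<in>U. SUP y\<in>U. ennreal (d x y))"

text \<open>
  Two-dimensional Hausdorff measure of a metric \<open>d\<close>; the factor \<open>\<pi>/4\<close> is the area of a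
  Euclidean disc of diameter \<open>1\<close>.
\<close>

definition hausdorff2 :: "('a \<Rightarrow> 'a \<Rightarrow> real) \<Rightarrow> 'a set \<Rightarrow> ennreal" where
  "hausdorff2 d E = (SUP \<delta>\<in>{0<..}.
     INF U\<in>{U :: nat \<Rightarrow> 'a set. E \<subseteq> (\<Union>i. U i) \<and> (\<forall>i. ediam d (U i) \<le> ennreal \<delta>)}.
       \<Sum>i. ennreal (pi / 4) * (ediam d (U i))\<^sup>2)"

text \<open>
  The surface area \<open>dA\<^sub>g\<close>: on an embedded surface the two-dimensional Hausdorff measure of the
  Riemannian distance is the area measure induced by \<open>g\<close>.
\<close>

definition g_area :: "(real^3 \<Rightarrow> real^3^3) \<Rightarrow> (real^3) measure" where
  "g_area g = measure_of UNIV (sets borel) (hausdorff2 (g_dist g))"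

definition g_grad :: "(real^3 \<Rightarrow> real^3^3) \<Rightarrow> (real^3 \<Rightarrow> real) \<Rightarrow> real^3 \<Rightarrow> real^3" where
  "g_grad g f x = matrix_inv (g x) *v grad f x"

section \<open>The operator \<open>L\<close> and its Green function\<close>

definition A_mat :: "(real^3 \<Rightarrow> real^3^3) \<Rightarrow> real^3 \<Rightarrow> real^3^3" where
  "A_mat g x = sqrt (det (g x)) *\<^sub>R matrix_inv (g x)"

definition B_mat :: "(real^3 \<Rightarrow> real^3^3) \<Rightarrow> real^3 \<Rightarrow> real^3^3" where
  "B_mat g x = mat 1 - A_mat g x"

definition L_op :: "(real^3 \<Rightarrow> real^3^3) \<Rightarrow> (real^3 \<Rightarrow> real) \<Rightarrow> real^3 \<Rightarrow> real" where
  "L_op g f = divergence (\<lambda>x. A_mat g x *v grad f x)"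

text \<open>
  The Green function is defined on the punctured space only; the value \<open>u 0\<close> is irrelevant.
\<close>

definition regular_value :: "(real^3 \<Rightarrow> real) \<Rightarrow> real \<Rightarrow> bool" where
  "regular_value u s \<longleftrightarrow> (\<forall>x. x \<noteq> 0 \<and> u x = s \<longrightarrow> grad u x \<noteq> 0)"

definition green_function :: "(real^3 \<Rightarrow> real^3^3) \<Rightarrow> (real^3 \<Rightarrow> real) \<Rightarrow> bool" where
  "green_function g u \<longleftrightarrow>
     smooth_on (- {0}) u \<and>
     (\<forall>x. x \<noteq> 0 \<longrightarrow> u x > 0) \<and>
     (\<forall>x. x \<noteq> 0 \<longrightarrow> L_op g u x = 0) \<and>
     filterlim u at_top (at 0) \<and>
     (u \<longlongrightarrow> 0) at_infinity \<and>
     (\<forall>s>0. regular_value u s \<longrightarrow>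
        (LINT x:{x. x \<noteq> 0 \<and> u x = s}|g_area g. g_norm g x (g_grad g u x)) = 4 * pi)"

definition P_int :: "(real^3 \<Rightarrow> real^3) \<Rightarrow> real \<Rightarrow> real \<Rightarrow> real^3" where
  "P_int X \<sigma> R = (1 / (4 * pi)) *\<^sub>R integral {x. norm x \<le> \<sigma> * R} X"

end

theory Submission
  imports Defs
begin

text \<open>
  Testing \<open>div (A \<nabla>u) = 0\<close> with \<open>\<eta>\<^sup>2 u\<close>, where \<open>\<eta>\<close> is the positive part of
  \<open>(|x|\<^sup>2 - a\<^sup>2)(b\<^sup>2 - |x|\<^sup>2)\<close>, and using \<open>u = O(1/|x|)\<close>, one gets the Caccioppoli bound
  \<open>\<integral> |\<nabla>u|\<^sup>2 = O(1/R)\<close> over the annulus \<open>\<sigma>\<^sub>1 R \<le> |x| \<le> \<sigma>\<^sub>2 R\<close>. Since \<open>|B| = o(1/R)\<close> there and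
  \<open>|\<nabla>u| \<le> R\<^sup>2 |\<nabla>u|\<^sup>2 + R\<^sup>-\<^sup>2\<close>, the integral of \<open>|B \<nabla>u|\<close> over the annulus is \<open>o(1)\<close>. The
  logarithmic bound follows by telescoping, because doubling \<open>\<sigma>\<close> amounts to one dyadic step in \<open>R\<close>.
\<close>

section \<open>Continuously differentiable functions on open sets\<close>

abbreviation C1_on :: "'a set \<Rightarrow> ('a::euclidean_space \<Rightarrow> 'b::real_normed_vector) \<Rightarrow> bool" where
  "C1_on \<equiv> Ck_on (Suc 0)"

text \<open>Naming the derivative \<open>f'\<close> lets later rules check continuity on an explicit
  formula; uniqueness of the Frechet derivative carries this over to
  \<open>frechet_derivative\<close>.\<close>

lemma C1_onI:
  assumes "open S" "\<And>x. x \<in> S \<Longrightarrow> (f has_derivative f' x) (at x)"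
    and "\<And>b. b \<in> Basis \<Longrightarrow> continuous_on S (\<lambda>x. f' x b)"
  shows "C1_on S f"
proof -
  have "frechet_derivative f (at x) = f' x" if "x \<in> S" for x
    by (rule frechet_derivative_at[OF assms(2)[OF that], symmetric])
  then have "continuous_on S (\<lambda>x. frechet_derivative f (at x) b)" if "b \<in> Basis" for b
    by (intro continuous_on_eq[OF assms(3)[OF that]]) simp
  moreover have "f differentiable_on S"
    unfolding differentiable_on_def
    by (rule ballI, rule differentiableI, rule has_derivative_at_withinI, rule assms(2))
  ultimately show ?thesis by simp
qed

lemma C1_on_has_derivative:
  assumes "C1_on S f" "open S" "x \<in> S"
  shows "(f has_derivative frechet_derivative f (at x)) (at x)"
proof -
  have "f differentiable (at x within S)"
    using assms(1,3) by (simp add: differentiable_on_def)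
  then show ?thesis
    by (simp add: at_within_open[OF assms(3,2)] frechet_derivative_works)
qed

lemma C1_on_continuous_derivative:
  "C1_on S f \<Longrightarrow> b \<in> Basis \<Longrightarrow> continuous_on S (\<lambda>x. frechet_derivative f (at x) b)"
  by simp

lemma C1_on_continuous: "C1_on S f \<Longrightarrow> continuous_on S f"
  by (simp add: differentiable_imp_continuous_on)

lemma C1_on_cong:
  assumes "open S" "\<And>x. x \<in> S \<Longrightarrow> f x = g x" "C1_on S f"
  shows "C1_on S g"
proof (rule C1_onI)
  show "(g has_derivative frechet_derivative f (at x)) (at x)" if "x \<in> S" for x
    using has_derivative_transform_within_open[OF C1_on_has_derivative[OF assms(3,1) that] assms(1) that assms(2)] .
qed (fact assms(1), rule C1_on_continuous_derivative[OF assms(3)])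

lemma C1_on_const: "open S \<Longrightarrow> C1_on S (\<lambda>x. c)"
  by (rule C1_onI[where f' = "\<lambda>_ _. 0"]) simp_all

lemma C1_on_bounded_linear:
  assumes "bounded_linear T" "C1_on S f" "open S"
  shows "C1_on S (\<lambda>x. T (f x))"
proof (rule C1_onI)
  show "((\<lambda>x. T (f x)) has_derivative (\<lambda>h. T (frechet_derivative f (at x) h))) (at x)"
    if "x \<in> S" for x
    by (rule bounded_linear.has_derivative[OF assms(1) C1_on_has_derivative[OF assms(2,3) that]])
  show "continuous_on S (\<lambda>x. T (frechet_derivative f (at x) b))" if "b \<in> Basis" for b
    by (rule bounded_linear.continuous_on[OF assms(1) C1_on_continuous_derivative[OF assms(2) that]])
qed fact

lemma C1_on_linear:
  assumes "bounded_linear T" "open S"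
  shows "C1_on S T"
  by (rule C1_onI[OF assms(2) bounded_linear_imp_has_derivative[OF assms(1)]]) simp

lemma C1_on_add:
  assumes "C1_on S f" "C1_on S g" "open S"
  shows "C1_on S (\<lambda>x. f x + g x)"
proof (rule C1_onI)
  show "((\<lambda>x. f x + g x) has_derivative
      (\<lambda>h. frechet_derivative f (at x) h + frechet_derivative g (at x) h)) (at x)" if "x \<in> S" for x
    by (rule has_derivative_add[OF C1_on_has_derivative[OF assms(1,3) that]
          C1_on_has_derivative[OF assms(2,3) that]])
  show "continuous_on S (\<lambda>x. frechet_derivative f (at x) b + frechet_derivative g (at x) b)"
    if "b \<in> Basis" for b
    by (rule continuous_on_add[OF C1_on_continuous_derivative[OF assms(1) that]
          C1_on_continuous_derivative[OF assms(2) that]])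
qed fact

lemma C1_on_mult:
  fixes f g :: "'a::euclidean_space \<Rightarrow> real"
  assumes "C1_on S f" "C1_on S g" "open S"
  shows "C1_on S (\<lambda>x. f x * g x)"
proof (rule C1_onI)
  show "((\<lambda>x. f x * g x) has_derivative
      (\<lambda>h. f x * frechet_derivative g (at x) h + frechet_derivative f (at x) h * g x)) (at x)"
    if "x \<in> S" for x
    by (rule has_derivative_mult[OF C1_on_has_derivative[OF assms(1,3) that]
          C1_on_has_derivative[OF assms(2,3) that]])
  show "continuous_on S
      (\<lambda>x. f x * frechet_derivative g (at x) b + frechet_derivative f (at x) b * g x)"
    if "b \<in> Basis" for b
    by (intro continuous_on_add continuous_on_mult C1_on_continuous[OF assms(1)]
        C1_on_continuous[OF assms(2)] C1_on_continuous_derivative[OF assms(1) that]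
        C1_on_continuous_derivative[OF assms(2) that])
qed fact

lemma C1_on_sum:
  assumes "open S" "\<And>i. i \<in> I \<Longrightarrow> C1_on S (f i)"
  shows "C1_on S (\<lambda>x. \<Sum>i\<in>I. f i x)"
  using assms(2)
  by (induction I rule: infinite_finite_induct)
     (auto simp del: Ck_on.simps intro!: C1_on_const C1_on_add \<open>open S\<close>)

lemma C1_on_prod:
  fixes f :: "'i \<Rightarrow> 'a::euclidean_space \<Rightarrow> real"
  assumes "open S" "\<And>i. i \<in> I \<Longrightarrow> C1_on S (f i)"
  shows "C1_on S (\<lambda>x. \<Prod>i\<in>I. f i x)"
  using assms(2)
  by (induction I rule: infinite_finite_induct)
     (auto simp del: Ck_on.simps intro!: C1_on_const C1_on_mult \<open>open S\<close>)

text \<open>Regularity of \<open>\<phi>\<close> is demanded only at values taken by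
  \<open>f\<close>, so that functions singular elsewhere, such as 1 / sqrt t, can be composed with a
  positive determinant.\<close>

lemma C1_on_compose_real:
  fixes f :: "'a::euclidean_space \<Rightarrow> real"
  assumes "C1_on S f" "open S" "continuous_on (f ` S) \<phi>'"
    and "\<And>x. x \<in> S \<Longrightarrow> (\<phi> has_real_derivative \<phi>' (f x)) (at (f x))"
  shows "C1_on S (\<lambda>x. \<phi> (f x))"
proof (rule C1_onI[where f' = "\<lambda>x b. \<phi>' (f x) * frechet_derivative f (at x) b"])
  show "((\<lambda>x. \<phi> (f x)) has_derivative (\<lambda>b. \<phi>' (f x) * frechet_derivative f (at x) b)) (at x)"
    if "x \<in> S" for x
    using has_derivative_compose[OF C1_on_has_derivative[OF assms(1,2) that]]
      assms(4)[OF that] unfolding has_field_derivative_def by blast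
  show "continuous_on S (\<lambda>x. \<phi>' (f x) * frechet_derivative f (at x) b)" if "b \<in> Basis" for b
    using that assms C1_on_continuous[OF assms(1)] C1_on_continuous_derivative[OF assms(1) that]
    by (intro continuous_on_mult continuous_on_compose2[OF assms(3)]) auto
qed fact

section \<open>Determinants, inverse matrices and the map G -> sqrt (det G) G^-1\<close>

lemma C1_on_det:
  fixes G :: "'a::euclidean_space \<Rightarrow> real^'n^'n"
  assumes "open S" "\<And>i j. C1_on S (\<lambda>x. G x $ i $ j)"
  shows "C1_on S (\<lambda>x. det (G x))"
  unfolding det_def
  by (intro C1_on_sum C1_on_mult C1_on_prod C1_on_const assms)

text \<open>Cramer's rule for A y = e_j, whose solution is the j-th column of the inverse. It turns
  \<open>matrix_inv\<close>, which is defined by a choice operator, into explicit quotients of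
  polynomials in the entries, and these can be differentiated.\<close>

lemma matrix_inv_component:
  fixes A :: "real^'n^'n"
  assumes "det A \<noteq> 0"
  shows "matrix_inv A $ k $ j = det (\<chi> i l. if l = k then axis j 1 $ i else A $ i $ l) / det A"
proof -
  have "\<exists>B. A ** B = mat 1 \<and> B ** A = mat 1"
    using assms invertible_det_nz[of A] by (auto simp: invertible_def)
  then have "A ** matrix_inv A = mat 1"
    unfolding matrix_inv_def by (metis (mono_tags, lifting) someI_ex)
  then have "A *v (matrix_inv A *v axis j 1) = axis j 1"
    by (simp add: matrix_vector_mul_assoc)
  then have "(matrix_inv A *v axis j 1) $ k
      = det (\<chi> i l. if l = k then axis j 1 $ i else A $ i $ l) / det A"
    unfolding cramer[OF assms] by (metis (no_types, lifting) vec_lambda_beta)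
  then show ?thesis
    by (simp add: matrix_vector_mul_component inner_axis)
qed

text \<open>By Cramer's rule each entry of the inverse is a determinant divided by det G. One factor
  sqrt (det G) cancels, which leaves that determinant over sqrt (det G), a C1 function where det G >
  0.\<close>

lemma C1_on_sqrt_det_inverse:
  fixes G :: "'a::euclidean_space \<Rightarrow> real^'n^'n"
  assumes "open S" "\<And>i j. C1_on S (\<lambda>x. G x $ i $ j)" "\<And>x. x \<in> S \<Longrightarrow> det (G x) > 0"
  shows "C1_on S (\<lambda>x. (sqrt (det (G x)) *\<^sub>R matrix_inv (G x)) $ k $ j)"
proof -
  let ?M = "\<lambda>x. \<chi> i l. if l = k then axis j 1 $ i else G x $ i $ l"
  have "C1_on S (\<lambda>x. (?M x) $ i $ l)" for i l
    using assms(1,2) by (cases "l = k") (simp_all del: Ck_on.simps add: C1_on_const)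
  then have "C1_on S (\<lambda>x. det (?M x))"
    by (rule C1_on_det[OF assms(1)])
  moreover have "C1_on S (\<lambda>x. 1 / sqrt (det (G x)))"
  proof (rule C1_on_compose_real[where \<phi> = "\<lambda>t. 1 / sqrt t"
        and \<phi>' = "\<lambda>t. - (inverse (sqrt t) / 2) / (sqrt t * sqrt t)"])
    show "C1_on S (\<lambda>x. det (G x))" by (rule C1_on_det[OF assms(1,2)])
    show "continuous_on ((\<lambda>x. det (G x)) ` S) (\<lambda>t. - (inverse (sqrt t) / 2) / (sqrt t * sqrt t))"
      using assms(3) by (intro continuous_intros) force+
  next
    fix x assume "x \<in> S"
    then show "((\<lambda>t. 1 / sqrt t) has_real_derivative
        - (inverse (sqrt (det (G x))) / 2) / (sqrt (det (G x)) * sqrt (det (G x)))) (at (det (G x)))"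
      using assms(3)[of x] by (auto intro!: derivative_eq_intros)
  qed fact
  ultimately have c1: "C1_on S (\<lambda>x. 1 / sqrt (det (G x)) * det (?M x))"
    using C1_on_mult assms(1) by blast
  have "1 / sqrt (det (G x)) * det (?M x)
      = (sqrt (det (G x)) *\<^sub>R matrix_inv (G x)) $ k $ j" if "x \<in> S" for x
    using assms(3)[OF that] by (simp add: matrix_inv_component field_simps)
  then show ?thesis
    by (rule C1_on_cong[OF assms(1) _ c1])
qed

text \<open>The map G -> sqrt (det G) G^-1 fixes the identity and is differentiable there, so a
  first-order expansion controls its deviation linearly. With G = \<open>g x\<close> this turns
  decay of g - I into decay of B.\<close>

lemma sqrt_det_inverse_lipschitz_at_1:
  "\<exists>d>0. \<exists>K>0. \<forall>G::real^'n^'n. norm (G - mat 1) < d \<longrightarrow>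
     norm (mat 1 - sqrt (det G) *\<^sub>R matrix_inv G) \<le> K * norm (G - mat 1)"
proof -
  define f :: "real^'n^'n \<Rightarrow> real^'n^'n" where "f = (\<lambda>G. sqrt (det G) *\<^sub>R matrix_inv G)"
  define S :: "(real^'n^'n) set" where "S = {G. 0 < det G}"
  have entry: "C1_on T (\<lambda>G::real^'n^'n. G $ i $ j)" if "open T" for T i j
    by (intro C1_on_linear that bounded_linear_compose[OF bounded_linear_vec_nth bounded_linear_vec_nth])
  have "continuous_on UNIV (det :: real^'n^'n \<Rightarrow> real)"
    by (rule C1_on_continuous, rule C1_on_det) (auto simp del: Ck_on.simps intro: entry)
  then have S: "open S"
    unfolding S_def by (intro open_Collect_less) auto
  have 1: "mat 1 \<in> S" by (simp add: S_def)
  have "(\<lambda>G. f G $ k $ j) differentiable (at (mat 1))" for k j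
  proof -
    have "C1_on S (\<lambda>G. f G $ k $ j)"
      unfolding f_def by (rule C1_on_sqrt_det_inverse[OF S]) (auto simp del: Ck_on.simps simp: S_def intro: entry S[unfolded S_def])
    from C1_on_has_derivative[OF this S 1] show ?thesis
      by (rule differentiableI)
  qed
  then have "f differentiable (at (mat 1))"
    by (subst differentiable_componentwise_within) (auto simp: Basis_vec_def inner_axis)
  then obtain f' where f': "(f has_derivative f') (at (mat 1))"
    by (auto simp: differentiable_def)
  then interpret f': bounded_linear f' by (rule has_derivative_bounded_linear)
  \<comment> \<open>\<open>K\<close> bounds the derivative at the identity; the remainder, taken
    with tolerance 1, adds one more multiple of \<open>norm (G - mat 1)\<close>. Hence the final
    constant \<open>K + 1\<close>.\<close>
  obtain K where K: "K > 0" "\<And>h. norm (f' h) \<le> norm h * K"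
    using f'.pos_bounded by blast
  obtain d where d: "d > 0" "\<And>G. norm (G - mat 1) < d \<Longrightarrow>
      norm (f G - f (mat 1) - f' (G - mat 1)) \<le> 1 * norm (G - mat 1)"
    using f' unfolding has_derivative_at_alt by (metis zero_less_one)
  have "mat 1 ** matrix_inv (mat 1 :: real^'n^'n) = mat 1"
    unfolding matrix_inv_def by (rule someI2[of _ "mat 1"]) auto
  then have f1: "f (mat 1) = mat 1" by (simp add: f_def)
  have "norm (mat 1 - f G) \<le> (K + 1) * norm (G - mat 1)" if "norm (G - mat 1) < d" for G
  proof -
    have "norm (mat 1 - f G) = norm ((f G - f (mat 1) - f' (G - mat 1)) + f' (G - mat 1))"
      by (simp add: f1 norm_minus_commute)
    also have "\<dots> \<le> 1 * norm (G - mat 1) + norm (G - mat 1) * K"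
      by (rule norm_triangle_mono[OF d(2)[OF that] K(2)])
    finally show ?thesis by (simp add: algebra_simps)
  qed
  then show ?thesis
    using d(1) K(1) unfolding f_def by (intro exI[of _ d] conjI exI[of _ "K + 1"]) auto
qed

text \<open>The determinant does not vanish on the segment joining \<open>G\<close> to the identity.\<close>

lemma det_pos_of_positive_definite:
  fixes G :: "real^'n^'n"
  assumes "\<And>v. v \<noteq> 0 \<Longrightarrow> v \<bullet> (G *v v) > 0"
  shows "det G > 0"
proof (rule ccontr)
  assume neg: "\<not> det G > 0"
  define H where "H = (\<lambda>t::real. t *\<^sub>R G + (1 - t) *\<^sub>R mat 1)"
  have "C1_on UNIV (\<lambda>G::real^'n^'n. G $ i $ j)" for i j
    by (intro C1_on_linear bounded_linear_compose[OF bounded_linear_vec_nth bounded_linear_vec_nth] open_UNIV)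
  then have "continuous_on UNIV (det :: real^'n^'n \<Rightarrow> real)"
    by (intro C1_on_continuous C1_on_det open_UNIV)
  then have "continuous_on {0..1} (\<lambda>t. det (H t))"
    unfolding H_def by (rule continuous_on_compose2) (auto intro!: continuous_intros)
  then obtain t where t: "0 \<le> t" "t \<le> 1" "det (H t) = 0"
    using IVT2'[of "\<lambda>t. det (H t)" 1 0 0] neg by (auto simp: H_def)
  have "\<exists>v. v \<noteq> 0 \<and> H t *v v = 0"
    using t(3) invertible_det_nz[of "H t"] matrix_left_invertible_ker[of "H t"] invertible_left_inverse[of "H t"] by auto
  then obtain v where v: "v \<noteq> 0" "H t *v v = 0" by blast
  have "v \<bullet> (H t *v v) = t * (v \<bullet> (G *v v)) + (1 - t) * (v \<bullet> v)"
    by (simp add: H_def matrix_vector_mult_add_rdistrib inner_add_right flip: scaleR_matrix_vector_assoc)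
  moreover have "v \<bullet> (G *v v) > 0" "v \<bullet> v > 0" using assms v(1) by auto
  ultimately have "0 < v \<bullet> (H t *v v)"
    using t(1,2) by (cases "t = 0") (auto intro!: add_pos_nonneg)
  then show False
    using v(2) by simp
qed

section \<open>Integrals of partial derivatives of compactly supported functions\<close>

lemma frechet_derivative_eq_0_outside:
  assumes "closed K" "\<And>x. x \<notin> K \<Longrightarrow> f x = 0" "x \<notin> K"
  shows "frechet_derivative f (at x) h = 0"
proof -
  have "((\<lambda>_. 0) has_derivative (\<lambda>_. 0)) (at x)" by simp
  then have "(f has_derivative (\<lambda>_. 0)) (at x)"
    by (rule has_derivative_transform_within_open[where s = "- K"]) (use assms in auto)
  then show ?thesis
    by (simp flip: frechet_derivative_at)
qed

text \<open>
  The difference quotients of \<open>f\<close> integrate to \<open>0\<close> by translation invariance and converge to the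
  partial derivative boundedly.
\<close>

lemma has_integral_partial_0:
  fixes f :: "'a::euclidean_space \<Rightarrow> real"
  assumes f: "C1_on UNIV f" and "compact K" and out: "\<And>x. x \<notin> K \<Longrightarrow> f x = 0" and e: "e \<in> Basis"
  shows "has_bochner_integral lborel (\<lambda>x. frechet_derivative f (at x) e) 0"
proof -
  define D where "D = (\<lambda>x. frechet_derivative f (at x) e)"
  have deriv: "(f has_derivative frechet_derivative f (at x)) (at x)" for x
    by (rule C1_on_has_derivative[OF f]) auto
  have contD: "continuous_on UNIV D"
    unfolding D_def by (rule C1_on_continuous_derivative[OF f e])
  have contf: "continuous_on UNIV f"
    by (rule C1_on_continuous[OF f])
  have D_out: "D x = 0" if "x \<notin> K" for x
    unfolding D_def using compact_imp_closed[OF \<open>compact K\<close>] out that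
    by (rule frechet_derivative_eq_0_outside)
  obtain r where r: "K \<subseteq> cball 0 r"
    using compact_imp_bounded[OF \<open>compact K\<close>] by (auto simp: bounded_iff subset_iff)
  have "bounded (D ` K)"
    using compact_continuous_image[OF continuous_on_subset[OF contD] \<open>compact K\<close>]
    by (auto intro: compact_imp_bounded)
  then obtain M where M: "M > 0" "\<And>x. x \<in> K \<Longrightarrow> \<bar>D x\<bar> \<le> M"
    unfolding bounded_pos by auto
  then have M': "\<bar>D x\<bar> \<le> M" for x
    using D_out[of x] by (cases "x \<in> K") auto
  define h where "h = (\<lambda>n::nat. 1 / real (Suc n))"
  have h: "0 < h n" "h n \<le> 1" for n
    by (auto simp: h_def divide_simps)
  have h0: "h \<longlonglongrightarrow> 0"
    unfolding h_def using LIMSEQ_inverse_real_of_nat by (simp add: inverse_eq_divide)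
  define s where "s = (\<lambda>n x. (f (h n *\<^sub>R e + x) - f x) / h n)"
  have line: "((\<lambda>t. f (t *\<^sub>R e + x)) has_real_derivative D (t *\<^sub>R e + x)) (at t)" for x t
  proof -
    have "((\<lambda>t. t *\<^sub>R e + x) has_derivative (\<lambda>t. t *\<^sub>R e)) (at t)"
      by (auto intro!: derivative_eq_intros)
    from has_derivative_compose[OF this deriv]
    have "((\<lambda>t. f (t *\<^sub>R e + x)) has_derivative
        (\<lambda>r. frechet_derivative f (at (t *\<^sub>R e + x)) (r *\<^sub>R e))) (at t)" .
    then show ?thesis
      unfolding has_field_derivative_def D_def
      by (simp add: linear_cmul[OF has_derivative_linear[OF deriv]] mult_commute_abs)
  qed
  have "(\<lambda>n. LINT x|lborel. s n x) \<longlonglongrightarrow> (LINT x|lborel. D x)"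
  proof (rule integral_dominated_convergence)
    \<comment> \<open>The shifts have length at most 1, so outside this enlarged ball both
      \<open>x\<close> and its translate miss \<open>K\<close> and the quotient is 0. Inside, the
      mean value theorem bounds it by \<open>M\<close>.\<close>
    show "integrable lborel (\<lambda>x. indicator (cball 0 (r + 1)) x *\<^sub>R M)"
      by (intro borel_integrable_compact) auto
    show "D \<in> borel_measurable lborel"
      using borel_measurable_continuous_onI[OF contD] by simp
    show "s n \<in> borel_measurable lborel" for n
    proof -
      have "continuous_on UNIV (s n)"
        unfolding s_def using h[of n]
        by (intro continuous_intros continuous_on_compose2[OF contf]) auto
      then show ?thesis
        using borel_measurable_continuous_onI by simp
    qed
    show "AE x in lborel. (\<lambda>n. s n x) \<longlonglongrightarrow> D x"
    proof (rule AE_I2)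
      fix x
      have "((\<lambda>t. (f (t *\<^sub>R e + x) - f x) / t) \<longlongrightarrow> D x) (at 0)"
        using line[of x 0] by (simp add: has_field_derivative_iff)
      moreover have "filterlim h (at 0) sequentially"
        using h0 h by (auto simp: filterlim_at intro!: always_eventually less_imp_neq[symmetric])
      ultimately show "(\<lambda>n. s n x) \<longlonglongrightarrow> D x"
        unfolding s_def by (rule filterlim_compose)
    qed
    show "AE x in lborel. norm (s n x) \<le> indicator (cball 0 (r + 1)) x *\<^sub>R M" for n
    proof (rule AE_I2)
      fix x
      show "norm (s n x) \<le> indicator (cball 0 (r + 1)) x *\<^sub>R M"
      proof (cases "x \<in> cball 0 (r + 1)")
        case True
        obtain z where "f (h n *\<^sub>R e + x) - f (0 *\<^sub>R e + x) = (h n - 0) * D (z *\<^sub>R e + x)"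
          using MVT2[OF h(1)[of n], of "\<lambda>t. f (t *\<^sub>R e + x)" "\<lambda>t. D (t *\<^sub>R e + x)"] line by blast
        then have "s n x = D (z *\<^sub>R e + x)"
          using h(1)[of n] by (simp add: s_def field_simps)
        then show ?thesis using M' True by simp
      next
        case False
        have "norm x - norm (h n *\<^sub>R e + x) \<le> norm (h n *\<^sub>R e)"
          using norm_triangle_ineq2[of x "h n *\<^sub>R e + x"] norm_minus_commute[of x "h n *\<^sub>R e + x"] by simp
        also have "\<dots> \<le> 1" using h[of n] e by simp
        finally have "h n *\<^sub>R e + x \<notin> K" "x \<notin> K"
          using False r by (auto simp: subset_iff)
        then show ?thesis using out False by (simp add: s_def)
      qed
    qed
  qed
  moreover have "(LINT x|lborel. s n x) = 0" for n
  proof -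
    have int: "integrable lborel f"
    proof -
      have "integrable lborel (\<lambda>x. indicator K x *\<^sub>R f x)"
        using \<open>compact K\<close> contf by (intro borel_integrable_compact) (auto intro: continuous_on_subset)
      moreover have "(\<lambda>x. indicator K x *\<^sub>R f x) = f"
        using out by (auto simp: indicator_def fun_eq_iff)
      ultimately show ?thesis by simp
    qed
    have meas: "f \<in> borel_measurable borel"
      using borel_measurable_continuous_onI[OF contf] .
    have "integrable (distr lborel borel ((+) (h n *\<^sub>R e))) f"
      using int by (simp add: lborel_distr_plus)
    then have int': "integrable lborel (\<lambda>x. f (h n *\<^sub>R e + x))"
      by (subst (asm) integrable_distr_eq) (use meas in auto)
    have "(LINT x|lborel. f (h n *\<^sub>R e + x)) = (LINT x|distr lborel borel ((+) (h n *\<^sub>R e)). f x)"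
      by (subst integral_distr) (use meas in auto)
    also have "\<dots> = (LINT x|lborel. f x)" by (simp add: lborel_distr_plus)
    finally show ?thesis
      unfolding s_def using int int' by simp
  qed
  ultimately have "(LINT x|lborel. D x) = 0"
    using LIMSEQ_unique[OF _ tendsto_const[of 0]] by simp
  moreover have "integrable lborel (\<lambda>x. indicator K x *\<^sub>R D x)"
    using \<open>compact K\<close> contD by (intro borel_integrable_compact) (auto intro: continuous_on_subset)
  moreover have "(\<lambda>x. indicator K x *\<^sub>R D x) = D"
    using D_out by (auto simp: indicator_def fun_eq_iff)
  ultimately show ?thesis
    by (simp add: has_bochner_integral_iff D_def)
qed

section \<open>Gradients and the energy estimate on an annulus\<close>

lemma partial_eq_derivative:
  assumes "(f has_derivative f') (at x)"
  shows "partial i f x = f' (axis i 1)"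
  unfolding partial_def by (simp flip: frechet_derivative_at[OF assms])

lemma C1_on_has_grad:
  assumes "C1_on S f" "open S" "x \<in> S"
  shows "(f has_derivative (\<lambda>h. grad f x \<bullet> h)) (at x)"
proof -
  note d = C1_on_has_derivative[OF assms]
  interpret linear "frechet_derivative f (at x)" by (rule has_derivative_linear[OF d])
  have "frechet_derivative f (at x) h = grad f x \<bullet> h" for h
  proof -
    have "frechet_derivative f (at x) h = frechet_derivative f (at x) (\<Sum>i\<in>UNIV. h $ i *\<^sub>R axis i 1)"
      using basis_expansion[of h] by (simp add: scalar_mult_eq_scaleR)
    also have "\<dots> = grad f x \<bullet> h"
      by (simp add: sum scale grad_def partial_def inner_vec_def mult.commute)
    finally show ?thesis .
  qed
  then show ?thesis using d by presburger
qed

text \<open>Serves to glue a function that is C1 away from the origin to its zero values near the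
  origin.\<close>

lemma C1_on_Un:
  assumes "C1_on S f" "C1_on T f" "open S" "open T"
  shows "C1_on (S \<union> T) f"
proof (rule C1_onI)
  show "(f has_derivative frechet_derivative f (at x)) (at x)" if "x \<in> S \<union> T" for x
    using that C1_on_has_derivative[OF assms(1,3)] C1_on_has_derivative[OF assms(2,4)] by blast
  show "continuous_on (S \<union> T) (\<lambda>x. frechet_derivative f (at x) b)" if "b \<in> Basis" for b
    by (rule continuous_on_open_Un[OF assms(3,4) C1_on_continuous_derivative[OF assms(1) that]
          C1_on_continuous_derivative[OF assms(2) that]])
qed (use assms in auto)

lemma C1_on_continuous_grad:
  assumes "C1_on S f"
  shows "continuous_on S (grad f)"
proof -
  have "continuous_on S (\<lambda>x. partial i f x)" for i
    unfolding partial_def by (rule C1_on_continuous_derivative[OF assms]) (simp add: axis_in_Basis_iff)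
  then show ?thesis
    unfolding grad_def by (intro continuous_on_vec_lambda)
qed

text \<open>Squaring removes the kink of the positive part at 0; this makes the squared cut-off of
  the energy estimate C1.\<close>

lemma has_real_derivative_max_0_square:
  "((\<lambda>t::real. (max 0 t)\<^sup>2) has_real_derivative 2 * max 0 t) (at t)"
proof -
  consider "t < 0" | "t = 0" | "t > 0" by linarith
  then show ?thesis
  proof cases
    case 1
    have "((\<lambda>_. 0) has_real_derivative 0) (at t)" by simp
    then show ?thesis
      using has_field_derivative_transform_within_open[of "\<lambda>_. 0" 0 t "{..<0}" "\<lambda>t. (max 0 t)\<^sup>2"] 1
      by simp
  next
    case 2
    \<comment> \<open>At 0 the difference quotient is max 0 h itself, which tends to 0.\<close>
    have "((\<lambda>h::real. max 0 h) \<longlongrightarrow> max 0 0) (at 0)" by (intro tendsto_intros)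
    moreover have "\<forall>\<^sub>F h in at 0. max 0 h = (max 0 h)\<^sup>2 / (h::real)"
      by (auto simp: eventually_at_filter max_def power2_eq_square)
    ultimately have "((\<lambda>h::real. (max 0 h)\<^sup>2 / h) \<longlongrightarrow> max 0 0) (at 0)"
      by (rule Lim_transform_eventually)
    then show ?thesis
      by (simp add: has_field_derivative_iff 2)
  next
    case 3
    have "((\<lambda>t. t\<^sup>2) has_real_derivative 2 * t) (at t)" by (auto intro!: derivative_eq_intros)
    then show ?thesis
      using has_field_derivative_transform_within_open[of "\<lambda>t. t\<^sup>2" "2 * t" t "{0<..}" "\<lambda>t. (max 0 t)\<^sup>2"] 3
      by simp
  qed
qed

text \<open>The coefficients enter only through \<open>ell\<close> and \<open>bdd\<close>, so
  \<open>W\<close> may be any divergence-free field comparable to the gradient. The field eta^2 u W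
  is supported in \<open>K\<close>, hence its divergence integrates to 0; ellipticity bounds the
  main term of this divergence from below, and the term with the derivative of eta^2 is absorbed by
  Young's inequality.\<close>

lemma caccioppoli_annulus:
  fixes u :: "real^'n \<Rightarrow> real" and W :: "real^'n \<Rightarrow> real^'n" and a b M :: real
  defines "K \<equiv> {x. a \<le> norm x \<and> norm x \<le> b}"
  assumes ab: "0 < a" "a < b"
    and u: "C1_on (- {0}) u" and W: "\<And>i. C1_on (- {0}) (\<lambda>x. W x $ i)"
    and div: "\<And>x. x \<noteq> 0 \<Longrightarrow> divergence W x = 0"
    and ell: "\<And>x. x \<in> K \<Longrightarrow> (norm (grad u x))\<^sup>2 \<le> 2 * (grad u x \<bullet> W x)"
    and bdd: "\<And>x. x \<in> K \<Longrightarrow> norm (W x) \<le> 2 * norm (grad u x)"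
    and M: "\<And>x. x \<in> K \<Longrightarrow> \<bar>u x\<bar> \<le> M"
  shows "(LINT x:K|lborel. ((x \<bullet> x - a\<^sup>2) * (b\<^sup>2 - x \<bullet> x))\<^sup>2 * (norm (grad u x))\<^sup>2)
    \<le> 256 * ((b\<^sup>2 - a\<^sup>2) * M * b)\<^sup>2 * measure lborel (K)"
proof -
  let ?S = "- {0::real^'n}"
  define L where "L = (b\<^sup>2 - a\<^sup>2) * M * b"
  define q where "q = (\<lambda>x::real^'n. (x \<bullet> x - a\<^sup>2) * (b\<^sup>2 - x \<bullet> x))"
  define \<Phi> where "\<Phi> = (\<lambda>x. (max 0 (q x))\<^sup>2)"
  \<comment> \<open>Since \<open>\<Phi>\<close> = eta^2 is radial, its gradient is c(x) x. The
    \<open>F i\<close> are the components of eta^2 u W, and \<open>G\<close> is the divergence of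
    that field on \<open>K\<close> once div W = 0 has been used.\<close>
  define c where "c = (\<lambda>x. 4 * max 0 (q x) * (a\<^sup>2 + b\<^sup>2 - 2 * (x \<bullet> x)))"
  define F where "F = (\<lambda>i x. \<Phi> x * u x * W x $ i)"
  define G where "G = (\<lambda>x. c x * u x * (x \<bullet> W x) + \<Phi> x * (grad u x \<bullet> W x))"
  have S: "open ?S" by auto
  have inner_sq: "x \<bullet> x = (norm x)\<^sup>2" for x :: "real^'n" by (simp add: power2_norm_eq_inner)
  have K: "compact K"
  proof -
    have "K = cball 0 b - ball 0 a" by (auto simp: K_def)
    then show ?thesis by (simp add: compact_diff)
  qed
  have KS: "K \<subseteq> ?S" using ab by (auto simp: K_def)
  have sq: "a\<^sup>2 \<le> x \<bullet> x" "x \<bullet> x \<le> b\<^sup>2" if "x \<in> K" for x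
    using that ab by (auto simp: K_def inner_sq intro!: power_mono)
  have q_K: "q x \<ge> 0" if "x \<in> K" for x
    unfolding q_def using sq[OF that] by simp
  have q_out: "q x \<le> 0" if "x \<notin> K" for x
  proof (cases "norm x < a")
    case True
    then have "x \<bullet> x \<le> a\<^sup>2" "x \<bullet> x \<le> b\<^sup>2" using ab by (auto simp: inner_sq intro!: power_mono)
    then show ?thesis unfolding q_def by (simp add: mult_nonpos_nonneg)
  next
    case False
    then have "a \<le> norm x" "b \<le> norm x" using that by (auto simp: K_def)
    then have "a\<^sup>2 \<le> x \<bullet> x" "b\<^sup>2 \<le> x \<bullet> x" using ab by (auto simp: inner_sq intro!: power_mono)
    then show ?thesis unfolding q_def by (simp add: mult_nonneg_nonpos)
  qed
  have \<Phi>': "(\<Phi> has_derivative (\<lambda>h. c x * (x \<bullet> h))) (at x)" for x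
  proof -
    have "(q has_derivative (\<lambda>h. 2 * (a\<^sup>2 + b\<^sup>2 - 2 * (x \<bullet> x)) * (x \<bullet> h))) (at x)"
      unfolding q_def
      by (auto intro!: derivative_eq_intros simp: fun_eq_iff inner_commute algebra_simps)
    from has_derivative_compose[OF this has_real_derivative_max_0_square[unfolded has_field_derivative_def]]
    show ?thesis
      by (simp add: \<Phi>_def c_def algebra_simps)
  qed
  have contq: "continuous_on T q" for T
    unfolding q_def by (intro continuous_intros)
  have contc: "continuous_on T c" for T
    unfolding c_def by (intro continuous_intros contq)
  have \<Phi>: "C1_on ?S \<Phi>"
    by (rule C1_onI[OF S \<Phi>']) (intro continuous_intros contc)
  have F_out: "F i x = 0" if "x \<notin> K" for i x
    using q_out[OF that] by (simp add: F_def \<Phi>_def)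
  have FS: "C1_on ?S (F i)" for i
    unfolding F_def by (intro C1_on_mult \<Phi> u W S)
  \<comment> \<open>Nothing is known about \<open>u\<close> and \<open>W\<close> at the origin, but
    the cut-off vanishes on this ball, so \<open>F i\<close> is C1 on the whole space.\<close>
  have "C1_on (ball 0 a) (F i)" for i
    by (rule C1_on_cong[OF open_ball _ C1_on_const[OF open_ball, of 0]])
       (use F_out in \<open>auto simp: K_def\<close>)
  then have "C1_on (?S \<union> ball 0 a) (F i)" for i
    using C1_on_Un[OF FS _ S open_ball] by blast
  moreover have "?S \<union> ball 0 a = UNIV" using ab by auto
  ultimately have "C1_on UNIV (F i)" for i by simp
  then have "has_bochner_integral lborel (\<lambda>x. partial i (F i) x) 0" for i
    unfolding partial_def by (rule has_integral_partial_0[OF _ K F_out]) (auto simp: axis_in_Basis_iff)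
  then have "has_bochner_integral lborel (\<lambda>x. \<Sum>i\<in>UNIV. partial i (F i) x) (\<Sum>i\<in>(UNIV::'n set). 0)"
    by (intro has_bochner_integral_sum)
  moreover have "(\<Sum>i\<in>UNIV. partial i (F i) x) = indicator K x *\<^sub>R G x" for x
  proof (cases "x \<in> K")
    case False
    have "partial i (F i) x = 0" for i
      unfolding partial_def by (rule frechet_derivative_eq_0_outside[OF compact_imp_closed[OF K] F_out False])
    then show ?thesis using False by simp
  next
    case True
    then have x: "x \<in> ?S" using KS by blast
    have "partial i (F i) x = c x * u x * (x $ i * W x $ i) + \<Phi> x * (grad u x $ i * W x $ i)
        + \<Phi> x * u x * partial i (\<lambda>y. W y $ i) x" for i
    proof -
      note W' = C1_on_has_derivative[OF W S x]
      show ?thesis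
        unfolding F_def
        by (subst partial_eq_derivative[OF has_derivative_mult[OF has_derivative_mult[OF \<Phi>'
              C1_on_has_grad[OF u S x]] W']])
           (simp add: partial_def inner_axis algebra_simps)
    qed
    then have "(\<Sum>i\<in>UNIV. partial i (F i) x) = G x + \<Phi> x * u x * divergence W x"
      by (simp add: sum.distrib G_def inner_vec_def divergence_def sum_distrib_left)
    then show ?thesis
      using div[of x] x True by simp
  qed
  ultimately have intG: "has_bochner_integral lborel (\<lambda>x. indicator K x *\<^sub>R G x) 0"
    by simp
  let ?E = "\<lambda>x. (q x)\<^sup>2 * (norm (grad u x))\<^sup>2"
  have "continuous_on K ?E"
    by (intro continuous_intros contq continuous_on_subset[OF C1_on_continuous_grad[OF u] KS])
  then have intE: "integrable lborel (\<lambda>x. indicator K x *\<^sub>R ?E x)"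
    by (rule borel_integrable_compact[OF K])
  have int1: "integrable lborel (\<lambda>x. indicator K x *\<^sub>R (64 * L\<^sup>2))"
    by (rule borel_integrable_compact[OF K]) auto
  \<comment> \<open>Ellipticity gives at least \<open>?E x / 2\<close>, and the cross term is at
    most 8 q |grad u| L, hence at most \<open>?E x / 4 + 64 * L\<^sup>2\<close>. As \<open>G\<close>
    integrates to 0, the constant of the lemma is 4 * 64 = 256.\<close>
  have pointwise: "?E x / 4 - 64 * L\<^sup>2 \<le> G x" if x: "x \<in> K" for x
  proof -
    let ?p = "norm (grad u x)"
    have \<Phi>x: "\<Phi> x = (q x)\<^sup>2" using q_K[OF x] by (simp add: \<Phi>_def)
    have "\<bar>c x * u x * (x \<bullet> W x)\<bar> \<le> (4 * q x * (b\<^sup>2 - a\<^sup>2)) * M * (b * (2 * ?p))"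
      unfolding abs_mult
    proof (intro mult_mono)
      \<comment> \<open>On \<open>K\<close> the number \<open>x \<bullet> x\<close> lies between the
        squares of \<open>a\<close> and \<open>b\<close>, so a^2 + b^2 - 2 |x|^2 has absolute value
        at most b^2 - a^2.\<close>
      show "\<bar>c x\<bar> \<le> 4 * q x * (b\<^sup>2 - a\<^sup>2)"
        unfolding c_def abs_mult using q_K[OF x] sq[OF x] by (intro mult_mono) auto
      have "norm x \<le> b" using x by (simp add: K_def)
      then show "\<bar>x \<bullet> W x\<bar> \<le> b * (2 * ?p)"
        using bdd[OF x] ab
        by (intro order_trans[OF Cauchy_Schwarz_ineq2] mult_mono) auto
      show "0 \<le> 4 * q x * (b\<^sup>2 - a\<^sup>2) * M"
        using q_K[OF x] sq[OF x] M[OF x] by (intro mult_nonneg_nonneg) auto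
    qed (use M[OF x] q_K[OF x] sq[OF x] in auto)
    also have "\<dots> = 8 * q x * ?p * L" by (simp add: L_def)
    also have "\<dots> \<le> ?E x / 4 + 64 * L\<^sup>2"
      using zero_le_power2[of "q x * ?p / 2 - 8 * L"] by (simp add: power2_eq_square algebra_simps)
    finally have 1: "\<bar>c x * u x * (x \<bullet> W x)\<bar> \<le> ?E x / 4 + 64 * L\<^sup>2" .
    have "?E x \<le> (q x)\<^sup>2 * (2 * (grad u x \<bullet> W x))"
      using ell[OF x] by (intro mult_left_mono) auto
    then show ?thesis using 1 by (simp add: G_def \<Phi>x)
  qed
  have "(LINT x|lborel. indicator K x *\<^sub>R ?E x) / 4 - 64 * L\<^sup>2 * measure lborel K
      = (LINT x|lborel. (indicator K x *\<^sub>R ?E x) / 4 - indicator K x *\<^sub>R (64 * L\<^sup>2))"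
    using K intE int1 by (simp add: fmeasurable_compact fmeasurableD compact_imp_closed)
  also have "\<dots> \<le> (LINT x|lborel. indicator K x *\<^sub>R G x)"
    using intG intE int1 pointwise
    by (intro integral_mono) (auto simp: indicator_def has_bochner_integral_iff)
  also have "\<dots> = 0"
    using intG by (simp add: has_bochner_integral_iff)
  finally show ?thesis
    by (simp add: set_lebesgue_integral_def q_def L_def)
qed

section \<open>The defect grad u - W over growing annuli\<close>

lemma annulus_integral_tendsto_0:
  fixes u :: "real^3 \<Rightarrow> real" and W :: "real^3 \<Rightarrow> real^3"
  assumes u: "C1_on (- {0}) u" and W: "\<And>i. C1_on (- {0}) (\<lambda>x. W x $ i)"
    and div: "\<And>x. x \<noteq> 0 \<Longrightarrow> divergence W x = 0"
    and decay: "\<And>x. norm x \<ge> 1 \<Longrightarrow> \<bar>u x\<bar> \<le> C / norm x"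
    and small: "\<And>e. e > 0 \<Longrightarrow> \<exists>r. \<forall>x. norm x \<ge> r \<longrightarrow>
        norm (grad u x - W x) \<le> e / norm x * norm (grad u x)"
    and st: "0 < s" "s < t"
  shows "((\<lambda>R. LINT x:{x. s * R \<le> norm x \<and> norm x \<le> t * R}|lborel. norm (grad u x - W x)) \<longlongrightarrow> 0) at_top"
proof (rule tendstoI)
  fix \<eta> :: real assume \<eta>: "\<eta> > 0"
  have "C \<ge> 0"
    using order_trans[OF abs_ge_zero decay[of "axis 1 1"]] by simp
  \<comment> \<open>Scale-free constants: \<open>V * R ^ 3\<close> bounds the volume of the widened
    annulus, \<open>R\<^sup>2 * \<Lambda>\<close> is the factor squared in the energy estimate for
    |u| at most C / a, \<open>c * R ^ 4\<close> bounds the weight from below on the given annulus,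
    and \<open>D\<close> collects the final bound.\<close>
  define V where "V = unit_ball_vol 3 * (2 * t) ^ 3"
  define \<Lambda> where "\<Lambda> = (4 * t\<^sup>2 - s\<^sup>2 / 4) * (4 * C * t / s)"
  define c where "c = (3 / 4 * s\<^sup>2) * (3 * t\<^sup>2)"
  define D where "D = 256 * \<Lambda>\<^sup>2 * V / c\<^sup>2 + V"
  have V: "V > 0" using st by (simp add: V_def)
  have c: "c > 0" using st by (simp add: c_def)
  have D: "D > 0" using V c by (simp add: D_def add_nonneg_pos)
  \<comment> \<open>The bound 1 / 2 yields the comparability of \<open>W\<close> with the gradient;
    the other bound turns the final estimate e D / s into at most \<eta> / 2.\<close>
  define e where "e = min (1 / 2) (\<eta> * s / (2 * D))"
  have e: "0 < e" "e \<le> 1 / 2" "e \<le> \<eta> * s / (2 * D)"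
    using \<eta> st D by (auto simp: e_def)
  obtain r where r: "\<And>x. norm x \<ge> r \<Longrightarrow> norm (grad u x - W x) \<le> e / norm x * norm (grad u x)"
    using small[OF e(1)] by blast
  have "(LINT x:{x. s * R \<le> norm x \<and> norm x \<le> t * R}|lborel. norm (grad u x - W x)) \<le> \<eta> / 2
      \<and> 0 \<le> (LINT x:{x. s * R \<le> norm x \<and> norm x \<le> t * R}|lborel. norm (grad u x - W x))"
    if R: "R \<ge> max 1 (2 * max 1 r / s)" for R
  proof
    \<comment> \<open>The annulus is widened by a factor 2 on both sides to leave room for the
      cut-off. The lower bound on \<open>R\<close> makes \<open>a\<close> at least max 1 r, so the
      decay of \<open>u\<close> and the smallness of the defect hold on all of
      \<open>K\<close>.\<close>
    define a b where "a = s * R / 2" and "b = 2 * t * R"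
    define K where "K = {x::real^3. a \<le> norm x \<and> norm x \<le> b}"
    define A where "A = {x::real^3. s * R \<le> norm x \<and> norm x \<le> t * R}"
    define q where "q = (\<lambda>x::real^3. (x \<bullet> x - a\<^sup>2) * (b\<^sup>2 - x \<bullet> x))"
    have R0: "R > 0" using R by simp
    have "2 * max 1 r / s \<le> R" using R by simp
    then have "max 1 r \<le> a" using st by (simp add: a_def field_simps)
    then have a: "1 \<le> a" "r \<le> a" by auto
    have "s * R < t * R" "0 < s * R" using st R0 by auto
    then have ab: "0 < a" "a < b" by (auto simp: a_def b_def)
    have AK: "A \<subseteq> K"
      using \<open>s * R < t * R\<close> \<open>0 < s * R\<close> by (auto simp: A_def K_def a_def b_def)
    have "K = cball 0 b - ball 0 a" by (auto simp: K_def)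
    then have K: "compact K" by (simp add: compact_diff)
    have "A = cball 0 (t * R) - ball 0 (s * R)" by (auto simp: A_def)
    then have A: "compact A" by (simp add: compact_diff)
    have KS: "K \<subseteq> - {0}" using ab by (auto simp: K_def)
    have pert: "norm (grad u x - W x) \<le> e / norm x * norm (grad u x)" if "x \<in> K" for x
      using r a that by (auto simp: K_def)
    \<comment> \<open>A defect of at most half the gradient gives both hypotheses of the energy
      estimate with constant 2.\<close>
    have half: "norm (grad u x - W x) \<le> norm (grad u x) / 2" if "x \<in> K" for x
    proof -
      have "1 \<le> norm x" using a that by (auto simp: K_def)
      then have "e / norm x \<le> e / 1" using e by (intro divide_left_mono) auto
      then have "e / norm x \<le> 1 / 2" using e by linarith
      then have "e / norm x * norm (grad u x) \<le> 1 / 2 * norm (grad u x)"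
        by (intro mult_right_mono) auto
      then show ?thesis using pert[OF that] by linarith
    qed
    have energy: "(LINT x:K|lborel. (q x)\<^sup>2 * (norm (grad u x))\<^sup>2)
        \<le> 256 * ((b\<^sup>2 - a\<^sup>2) * (C / a) * b)\<^sup>2 * measure lborel K"
      unfolding K_def q_def
    proof (rule caccioppoli_annulus[OF ab u W div], simp_all flip: K_def)
      fix x assume x: "x \<in> K"
      have "grad u x \<bullet> (grad u x - W x) \<le> norm (grad u x) * (norm (grad u x) / 2)"
        by (rule order_trans[OF norm_cauchy_schwarz mult_left_mono[OF half[OF x]]]) simp
      then show "(norm (grad u x))\<^sup>2 \<le> 2 * (grad u x \<bullet> W x)"
        by (simp add: inner_diff_right power2_norm_eq_inner flip: power2_eq_square)
      have "norm (W x) \<le> norm (grad u x) + norm (grad u x - W x)"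
        using norm_triangle_ineq4[of "grad u x" "grad u x - W x"] by simp
      then show "norm (W x) \<le> 2 * norm (grad u x)"
        using half[OF x] norm_ge_zero[of "grad u x"] by linarith
      have "C / norm x \<le> C / a"
        using x ab \<open>C \<ge> 0\<close> by (intro divide_left_mono) (auto simp: K_def intro!: mult_pos_pos)
      then show "\<bar>u x\<bar> \<le> C / a"
        using decay[of x] x a by (auto simp: K_def)
    qed
    have vol: "measure lborel K \<le> V * R ^ 3"
    proof -
      have "measure lborel K \<le> measure lborel (cball (0::real^3) b)"
        using K by (intro measure_mono_fmeasurable fmeasurable_compact)
            (auto simp: K_def compact_imp_closed)
      also have "\<dots> = unit_ball_vol 3 * b ^ 3"
        using content_cball[of b "0::real^3"] ab by simp
      also have "\<dots> = V * R ^ 3"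
        by (simp add: V_def b_def power_mult_distrib)
      finally show ?thesis .
    qed
    have "(b\<^sup>2 - a\<^sup>2) * (C / a) * b = R\<^sup>2 * \<Lambda>"
      using st R0 by (simp add: a_def b_def \<Lambda>_def power2_eq_square field_simps)
    then have "256 * ((b\<^sup>2 - a\<^sup>2) * (C / a) * b)\<^sup>2 * measure lborel K
        \<le> 256 * (R\<^sup>2 * \<Lambda>)\<^sup>2 * (V * R ^ 3)"
      using vol by (simp add: mult_left_mono)
    with energy have energy': "(LINT x:K|lborel. (q x)\<^sup>2 * (norm (grad u x))\<^sup>2)
        \<le> 256 * (R\<^sup>2 * \<Lambda>)\<^sup>2 * (V * R ^ 3)" by linarith
    have q: "c * R ^ 4 \<le> q x" if "x \<in> A" for x
    proof -
      have "(s * R)\<^sup>2 \<le> (norm x)\<^sup>2" "(norm x)\<^sup>2 \<le> (t * R)\<^sup>2"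
        using that \<open>0 < s * R\<close> by (auto simp: A_def intro!: power_mono)
      then have "3 / 4 * s\<^sup>2 * R\<^sup>2 \<le> x \<bullet> x - a\<^sup>2" "3 * t\<^sup>2 * R\<^sup>2 \<le> b\<^sup>2 - x \<bullet> x"
        by (simp_all add: a_def b_def power2_norm_eq_inner[symmetric] power_mult_distrib power_divide mult.commute)
      moreover have "0 \<le> 3 / 4 * s\<^sup>2 * R\<^sup>2" "0 \<le> 3 * t\<^sup>2 * R\<^sup>2" by simp_all
      ultimately have "(3 / 4 * s\<^sup>2 * R\<^sup>2) * (3 * t\<^sup>2 * R\<^sup>2) \<le> q x"
        unfolding q_def by (intro mult_mono) linarith+
      then show ?thesis by (simp add: c_def power2_eq_square power4_eq_xxxx algebra_simps)
    qed
    have cont: "continuous_on K (grad u)"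
      by (rule continuous_on_subset[OF C1_on_continuous_grad[OF u] KS])
    have "continuous_on K (\<lambda>x. \<chi> i. W x $ i)"
      by (intro continuous_on_vec_lambda continuous_on_subset[OF C1_on_continuous[OF W] KS])
    then have contW: "continuous_on K W" by simp
    have intE: "integrable lborel (\<lambda>x. indicator K x *\<^sub>R ((q x)\<^sup>2 * (norm (grad u x))\<^sup>2))"
      unfolding q_def by (intro borel_integrable_compact K continuous_intros cont)
    have int1: "integrable lborel (\<lambda>x. indicator K x *\<^sub>R (1 / R\<^sup>2))"
      by (intro borel_integrable_compact K continuous_intros)
    have intB: "integrable lborel (\<lambda>x. indicator A x *\<^sub>R norm (grad u x - W x))"
      by (intro borel_integrable_compact A continuous_intros continuous_on_subset[OF cont AK]
          continuous_on_subset[OF contW AK])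
    \<comment> \<open>From (R p - 1/R)^2 \<ge> 0 one gets p \<le> R^2 p^2 + 1/R^2 for p = |grad u|.
      These weights balance: the energy is O(1/R) and the volume O(R^3), so both terms integrate to
      O(R), which the prefactor e / (s R) cancels. The lower bound on the weight gives R^2 p^2 \<le>
      q^2 p^2 / (c^2 R^6).\<close>
    have pointwise: "norm (grad u x - W x)
        \<le> e / (s * R) * (((q x)\<^sup>2 * (norm (grad u x))\<^sup>2) / (c\<^sup>2 * R ^ 6) + 1 / R\<^sup>2)" if x: "x \<in> A" for x
    proof -
      let ?p = "norm (grad u x)"
      have "norm (grad u x - W x) \<le> e / norm x * ?p" using pert x AK by blast
      also have "\<dots> \<le> e / (s * R) * ?p"
        using x e \<open>0 < s * R\<close> by (intro mult_right_mono frac_le) (auto simp: A_def)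
      also have "\<dots> \<le> e / (s * R) * (((q x)\<^sup>2 * ?p\<^sup>2) / (c\<^sup>2 * R ^ 6) + 1 / R\<^sup>2)"
      proof (rule mult_left_mono)
        have "0 \<le> (R * ?p - 1 / R)\<^sup>2" by simp
        also have "\<dots> = R\<^sup>2 * ?p\<^sup>2 + 1 / R\<^sup>2 - 2 * ?p"
          using R0 by (simp add: power2_eq_square field_simps)
        finally have "?p \<le> R\<^sup>2 * ?p\<^sup>2 + 1 / R\<^sup>2" using norm_ge_zero[of "grad u x"] by linarith
        moreover have "R\<^sup>2 * ?p\<^sup>2 \<le> ((q x)\<^sup>2 * ?p\<^sup>2) / (c\<^sup>2 * R ^ 6)"
        proof -
          have "(c * R ^ 4)\<^sup>2 \<le> (q x)\<^sup>2" using q[OF x] c R0 by (intro power_mono) auto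
          then have "(c * R ^ 4)\<^sup>2 * ?p\<^sup>2 \<le> (q x)\<^sup>2 * ?p\<^sup>2" by (intro mult_right_mono) auto
          moreover have "(c * R ^ 4)\<^sup>2 = c\<^sup>2 * R ^ 6 * R\<^sup>2"
            by (simp add: power_mult_distrib flip: power_mult power_add)
          ultimately show ?thesis using c R0 by (simp add: pos_le_divide_eq mult_ac)
        qed
        ultimately show "?p \<le> ((q x)\<^sup>2 * ?p\<^sup>2) / (c\<^sup>2 * R ^ 6) + 1 / R\<^sup>2" by linarith
      qed (use e \<open>0 < s * R\<close> in auto)
      finally show ?thesis .
    qed
    have "(LINT x:A|lborel. norm (grad u x - W x))
        \<le> (LINT x|lborel. e / (s * R) * ((indicator K x *\<^sub>R ((q x)\<^sup>2 * (norm (grad u x))\<^sup>2)) / (c\<^sup>2 * R ^ 6)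
              + indicator K x *\<^sub>R (1 / R\<^sup>2)))"
      unfolding set_lebesgue_integral_def
    proof (rule integral_mono[OF intB])
      show "indicator A x *\<^sub>R norm (grad u x - W x)
        \<le> e / (s * R) * ((indicator K x *\<^sub>R ((q x)\<^sup>2 * (norm (grad u x))\<^sup>2)) / (c\<^sup>2 * R ^ 6)
              + indicator K x *\<^sub>R (1 / R\<^sup>2))" for x
        using pointwise[of x] AK e \<open>0 < s * R\<close>
        by (cases "x \<in> A") (auto simp: indicator_def intro!: mult_nonneg_nonneg add_nonneg_nonneg)
    qed (use intE int1 in \<open>auto intro!: integrable_mult_right integrable_add integrable_divide\<close>)
    also have "\<dots> = e / (s * R) * ((LINT x:K|lborel. (q x)\<^sup>2 * (norm (grad u x))\<^sup>2) / (c\<^sup>2 * R ^ 6)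
        + measure lborel K / R\<^sup>2)"
      using intE int1 K
      by (simp add: set_lebesgue_integral_def compact_imp_closed fmeasurable_compact fmeasurableD)
    also have "\<dots> \<le> e / (s * R) * (256 * (R\<^sup>2 * \<Lambda>)\<^sup>2 * (V * R ^ 3) / (c\<^sup>2 * R ^ 6) + V * R ^ 3 / R\<^sup>2)"
      using energy' vol e \<open>0 < s * R\<close> R0
      by (intro mult_left_mono add_mono divide_right_mono) auto
    also have "\<dots> = e / s * D"
      using c R0 st by (simp add: D_def field_simps power2_eq_square eval_nat_numeral)
    also have "\<dots> \<le> \<eta> * s / (2 * D) / s * D"
      using e D st by (intro mult_right_mono divide_right_mono) auto
    also have "\<dots> = \<eta> / 2" using D st by simp
    finally show "(LINT x:{x. s * R \<le> norm x \<and> norm x \<le> t * R}|lborel. norm (grad u x - W x)) \<le> \<eta> / 2"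
      unfolding A_def .
    show "0 \<le> (LINT x:{x. s * R \<le> norm x \<and> norm x \<le> t * R}|lborel. norm (grad u x - W x))"
      unfolding set_lebesgue_integral_def by (intro integral_nonneg_AE) auto
  qed
  then show "\<forall>\<^sub>F R in at_top. dist (LINT x:{x. s * R \<le> norm x \<and> norm x \<le> t * R}|lborel.
      norm (grad u x - W x)) 0 < \<eta>"
    using \<eta> unfolding eventually_at_top_linorder
    by (intro exI[of _ "max 1 (2 * max 1 r / s)"]) (force simp: abs_if)
qed

section \<open>Telescoping, decay of B and differences of ball integrals\<close>

text \<open>A Stolz-Cesaro argument: from some index \<open>m\<close> on the increments have norm
  below e / 2, so the growth is at most linear with slope e / 2, and for large n the fixed term
  \<open>norm (p m)\<close> is below the other e n / 2.\<close>

lemma tendsto_div_of_diff_tendsto_0: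
  fixes p :: "nat \<Rightarrow> 'a::real_normed_vector"
  assumes "(\<lambda>n. p (Suc n) - p n) \<longlonglongrightarrow> 0"
  shows "(\<lambda>n. norm (p n) / real n) \<longlonglongrightarrow> 0"
proof (rule LIMSEQ_I)
  fix e :: real assume e: "e > 0"
  obtain m where m: "\<And>n. n \<ge> m \<Longrightarrow> norm (p (Suc n) - p n) < e / 2"
    using LIMSEQ_D[OF assms, of "e / 2"] e by auto
  have bound: "norm (p n) \<le> norm (p m) + (e / 2) * (n - m)" if "n \<ge> m" for n
    using that
  proof (induction n rule: dec_induct)
    case (step n)
    have "norm (p (Suc n)) \<le> norm (p n) + norm (p (Suc n) - p n)"
      by (metis add.commute diff_add_cancel norm_triangle_ineq)
    then show ?case
      using step m[of n] by (simp add: of_nat_diff add_divide_distrib diff_divide_distrib algebra_simps)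
  qed simp
  obtain k :: nat where k: "k > 2 * norm (p m) / e" using reals_Archimedean2 by blast
  show "\<exists>N. \<forall>n\<ge>N. norm (norm (p n) / real n - 0) < e"
  proof (intro exI allI impI)
    fix n assume n: "n \<ge> max 1 (max m k)"
    have "norm (p m) < e / 2 * k" using k e by (simp add: field_simps)
    also have "\<dots> \<le> e / 2 * n" using n e by (intro mult_left_mono) auto
    finally have "norm (p m) < e / 2 * n" .
    moreover have "e / 2 * real (n - m) \<le> e / 2 * n"
      using e by (intro mult_left_mono) auto
    ultimately have "norm (p n) < e * n"
      using bound[of n] n by simp
    then show "norm (norm (p n) / real n - 0) < e"
      using n by (simp add: field_simps)
  qed
qed

lemma C1_on_subset:
  assumes "C1_on S f" "open S" "open T" "T \<subseteq> S"
  shows "C1_on T f"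
  by (rule C1_onI[OF assms(3) C1_on_has_derivative[OF assms(1,2)]
        continuous_on_subset[OF C1_on_continuous_derivative[OF assms(1)] assms(4)]])
     (use assms(4) in auto)

text \<open>Row by row Cauchy-Schwarz, each row being bounded by the norm of the whole matrix; the
  number of rows is a crude but sufficient constant.\<close>

lemma norm_matrix_vector_mult_le:
  fixes A :: "real^'n^'m"
  shows "norm (A *v x) \<le> real CARD('m) * (norm A * norm x)"
proof -
  have "norm (A *v x) \<le> (\<Sum>i\<in>UNIV. norm ((A *v x) $ i))"
    unfolding norm_vec_def[of "A *v x"] by (rule L2_set_le_sum) auto
  also have "\<dots> \<le> (\<Sum>i\<in>(UNIV::'m set). norm A * norm x)"
    unfolding matrix_vector_mul_component real_norm_def
    by (intro sum_mono order_trans[OF Cauchy_Schwarz_ineq2] mult_right_mono Finite_Cartesian_Product.norm_nth_le) auto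
  finally show ?thesis by simp
qed

lemma B_mat_small:
  assumes "(\<lambda>x. norm (g x - mat 1)) \<in> o[at_infinity](\<lambda>x. 1 / norm x)" and "e > 0"
  shows "\<exists>r. \<forall>x. norm x \<ge> r \<longrightarrow> (\<forall>v. norm (B_mat g x *v v) \<le> e / norm x * norm v)"
proof -
  obtain d K where d: "d > 0" and K: "K > 0"
    and lip: "\<And>G::real^3^3. norm (G - mat 1) < d \<Longrightarrow>
      norm (mat 1 - sqrt (det G) *\<^sub>R matrix_inv G) \<le> K * norm (G - mat 1)"
    using sqrt_det_inverse_lipschitz_at_1 by blast
  \<comment> \<open>The 3 is the number of rows lost in \<open>norm_matrix_vector_mult_le\<close>,
    and \<open>K\<close> is the constant of the linear bound at the identity.\<close>
  define c where "c = e / (3 * K)"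
  have c: "c > 0" using assms(2) K by (simp add: c_def)
  obtain r where r: "\<And>x. norm x \<ge> r \<Longrightarrow> norm (g x - mat 1) \<le> c / norm x"
    using landau_o.smallD[OF assms(1) c] by (auto simp: eventually_at_infinity)
  show ?thesis
  proof (intro exI allI impI)
    \<comment> \<open>The term \<open>2 * c / d\<close> in the radius forces c / |x| < d, so that
      \<open>g x\<close> lies where the linear bound is valid.\<close>
    fix x v :: "real^3" assume x: "norm x \<ge> max r (max 1 (2 * c / d))"
    have "2 * c / d \<le> norm x" "norm x > 0" using x by auto
    then have "c / norm x < d"
      using c d by (simp add: field_simps)
    then have "norm (g x - mat 1) < d" using r[of x] x by simp
    then have "norm (B_mat g x) \<le> K * norm (g x - mat 1)"
      unfolding B_mat_def A_mat_def by (rule lip)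
    also have "\<dots> \<le> K * (c / norm x)" using r[of x] x K by (intro mult_left_mono) auto
    finally have "3 * norm (B_mat g x) \<le> e / norm x"
      using K by (simp add: c_def)
    then have "3 * norm (B_mat g x) * norm v \<le> e / norm x * norm v"
      by (intro mult_right_mono) auto
    then show "norm (B_mat g x *v v) \<le> e / norm x * norm v"
      using norm_matrix_vector_mult_le[of "B_mat g x" v] by simp
  qed
qed

text \<open>The two balls differ by an annulus. It is taken closed, hence compact; the added inner
  sphere only increases an upper bound, and the factor 1 / (4 pi) is estimated by 1.\<close>

lemma P_int_diff_le:
  fixes X :: "real^3 \<Rightarrow> real^3"
  assumes X: "continuous_on UNIV X" and "0 \<le> R" "s \<le> t"
  shows "norm (P_int X t R - P_int X s R)
    \<le> (LINT x:{x. s * R \<le> norm x \<and> norm x \<le> t * R}|lborel. norm (X x))"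
proof -
  define A where "A = {x::real^3. s * R \<le> norm x \<and> norm x \<le> t * R}"
  have int: "integrable lborel (\<lambda>x. indicator (cball 0 r) x *\<^sub>R X x)" for r
    using X by (intro borel_integrable_compact) (auto intro: continuous_on_subset)
  \<comment> \<open>\<open>P_int\<close> is a gauge integral. Since X is absolutely integrable on
    balls, it agrees with the Lebesgue integral used in the estimates.\<close>
  have ball: "P_int X \<sigma> R = (1 / (4 * pi)) *\<^sub>R (LINT x|lborel. indicator (cball 0 (\<sigma> * R)) x *\<^sub>R X x)" for \<sigma>
  proof -
    have "{x::real^3. norm x \<le> \<sigma> * R} = cball 0 (\<sigma> * R)" by auto
    then show ?thesis
      using set_borel_integral_eq_integral(2)[of "cball 0 (\<sigma> * R)" X] int
      by (simp add: P_int_def set_integrable_def set_lebesgue_integral_def)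
  qed
  have "A = cball 0 (t * R) - ball 0 (s * R)" by (auto simp: A_def)
  then have A: "compact A" by (simp add: compact_diff)
  have intA: "integrable lborel (\<lambda>x. indicator A x *\<^sub>R norm (X x))"
    using X A by (intro borel_integrable_compact continuous_intros) (auto intro: continuous_on_subset)
  have "s * R \<le> t * R" using assms by (intro mult_right_mono) auto
  have "norm (P_int X t R - P_int X s R) = (1 / (4 * pi)) * norm (LINT x|lborel.
      indicator (cball 0 (t * R)) x *\<^sub>R X x - indicator (cball 0 (s * R)) x *\<^sub>R X x)"
    using int by (simp add: ball flip: scaleR_diff_right)
  also have "\<dots> \<le> 1 * norm (LINT x|lborel.
      indicator (cball 0 (t * R)) x *\<^sub>R X x - indicator (cball 0 (s * R)) x *\<^sub>R X x)"
    using pi_gt3 by (intro mult_right_mono) auto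
  also have "\<dots> \<le> (LINT x|lborel. norm (
      indicator (cball 0 (t * R)) x *\<^sub>R X x - indicator (cball 0 (s * R)) x *\<^sub>R X x))"
    by simp
  also have "\<dots> \<le> (LINT x|lborel. indicator A x *\<^sub>R norm (X x))"
    using int intA \<open>s * R \<le> t * R\<close>
    by (intro integral_mono integrable_norm Bochner_Integration.integrable_diff)
       (auto simp: indicator_def A_def)
  finally show ?thesis
    by (simp add: set_lebesgue_integral_def A_def)
qed

section \<open>Application to the Green function along dyadic radii\<close>

theorem lemma3p2:
  fixes g :: "real^3 \<Rightarrow> real^3^3"
    and u :: "real^3 \<Rightarrow> real"
    and X :: "real^3 \<Rightarrow> real^3"
    and c0 C0 :: real
  assumes "riemannian_metric g"
    and "complete_metric g"
    and "(\<lambda>x. norm (g x - mat 1)) \<in> o[at_infinity](\<lambda>x. 1 / norm x)"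
    and "green_function g u"
    and "0 < c0" and "c0 \<le> C0"
    and "\<And>x. norm x \<ge> 1 \<Longrightarrow> c0 / norm x \<le> u x \<and> u x \<le> C0 / norm x"
    and "smooth_on UNIV X"
    and "\<And>x. x \<notin> ball 0 (1/16) \<Longrightarrow> X x = B_mat g x *v grad u x"
  shows "(\<forall>\<sigma>>0. (\<lambda>N::nat. norm (P_int X \<sigma> (2 ^ N))) \<in> o(\<lambda>N. ln (2 ^ N))) \<and>
         (\<forall>\<sigma>1 \<sigma>2. 0 < \<sigma>1 \<and> \<sigma>1 < \<sigma>2 \<longrightarrow>
            (\<lambda>N::nat. norm (P_int X \<sigma>2 (2 ^ N) - P_int X \<sigma>1 (2 ^ N))) \<in> o(\<lambda>N. 1))"
proof -
  define W where "W = (\<lambda>x. A_mat g x *v grad u x)"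
  have X: "continuous_on UNIV X"
    using assms(8) unfolding smooth_on_def by (metis Ck_on.simps(1))
  have g: "C1_on UNIV g"
    using assms(1) unfolding riemannian_metric_def smooth_on_def by blast
  have g_entry: "C1_on UNIV (\<lambda>x. g x $ i $ j)" for i j
    by (intro C1_on_bounded_linear[OF _ g, where T = "\<lambda>G. G $ i $ j"]
        bounded_linear_compose[OF bounded_linear_vec_nth bounded_linear_vec_nth] open_UNIV)
  have "det (g x) > 0" for x
    using assms(1) det_pos_of_positive_definite unfolding riemannian_metric_def by blast
  then have "C1_on UNIV (\<lambda>x. A_mat g x $ i $ j)" for i j
    unfolding A_mat_def by (intro C1_on_sqrt_det_inverse g_entry) auto
  then have A: "C1_on (- {0}) (\<lambda>x. A_mat g x $ i $ j)" for i j
    by (rule C1_on_subset) auto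
  \<comment> \<open>Two orders of regularity of \<open>u\<close> are extracted because
    \<open>W\<close> contains its gradient and must itself be C1.\<close>
  have u2: "Ck_on (Suc (Suc 0)) (- {0}) u" and div: "x \<noteq> 0 \<Longrightarrow> divergence W x = 0" for x
    using assms(4) unfolding green_function_def smooth_on_def L_op_def W_def by blast+
  have u: "C1_on (- {0}) u"
    using u2 differentiable_imp_continuous_on by auto
  have "C1_on (- {0}) (\<lambda>x. grad u x $ i)" for i
    using u2 unfolding grad_def partial_def by (simp add: axis_in_Basis_iff)
  then have W: "C1_on (- {0}) (\<lambda>x. W x $ i)" for i
    unfolding W_def matrix_vector_mul_component inner_vec_def inner_real_def
    by (intro C1_on_sum C1_on_mult A) auto
  have WB: "grad u x - W x = B_mat g x *v grad u x" for x
    by (simp add: W_def B_mat_def matrix_vector_mult_diff_rdistrib)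
  have decay: "\<bar>u x\<bar> \<le> C0 / norm x" if "norm x \<ge> 1" for x
  proof -
    have "0 < c0 / norm x" using assms(5) that by (intro divide_pos_pos) auto
    then show ?thesis using assms(7)[OF that] by auto
  qed
  have pow: "filterlim (\<lambda>N::nat. 2 ^ N :: real) at_top sequentially"
    by (intro filterlim_at_infinity_imp_filterlim_at_top filterlim_realpow_sequentially_gt1) auto
  have diff: "(\<lambda>N. P_int X t (2 ^ N) - P_int X s (2 ^ N)) \<longlonglongrightarrow> 0" if st: "0 < s" "s < t" for s t
  proof (rule Lim_null_comparison)
    have small: "\<exists>r. \<forall>x. norm x \<ge> r \<longrightarrow> norm (grad u x - W x) \<le> e / norm x * norm (grad u x)"
      if "e > 0" for e
      using B_mat_small[OF assms(3) that] unfolding WB by blast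
    show "(\<lambda>N. LINT x:{x. s * 2 ^ N \<le> norm x \<and> norm x \<le> t * 2 ^ N}|lborel.
        norm (grad u x - W x)) \<longlonglongrightarrow> 0"
      by (rule filterlim_compose[OF annulus_integral_tendsto_0[OF u W div decay small st] pow])
    \<comment> \<open>From here on the inner radius s 2^N is at least 1/16, so on the whole annulus
      X equals B grad u = grad u - W.\<close>
    have "\<forall>\<^sub>F N in sequentially. 1 / (16 * s) \<le> 2 ^ N"
      using pow unfolding filterlim_at_top by blast
    then show "\<forall>\<^sub>F N in sequentially. norm (P_int X t (2 ^ N) - P_int X s (2 ^ N))
        \<le> (LINT x:{x. s * 2 ^ N \<le> norm x \<and> norm x \<le> t * 2 ^ N}|lborel. norm (grad u x - W x))"
    proof eventually_elim
      case (elim N)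
      then have "1 / 16 \<le> s * 2 ^ N" using st by (simp add: field_simps)
      then have "X x = grad u x - W x" if "s * 2 ^ N \<le> norm x" for x
        using assms(9)[of x] that by (simp add: WB)
      then have "(LINT x:{x. s * 2 ^ N \<le> norm x \<and> norm x \<le> t * 2 ^ N}|lborel. norm (X x))
          = (LINT x:{x. s * 2 ^ N \<le> norm x \<and> norm x \<le> t * 2 ^ N}|lborel. norm (grad u x - W x))"
        unfolding set_lebesgue_integral_def
        by (intro Bochner_Integration.integral_cong) (auto simp: indicator_def)
      then show ?case
        using P_int_diff_le[OF X, of "2 ^ N" s t] st by simp
    qed
  qed
  have "(\<lambda>N::nat. norm (P_int X \<sigma> (2 ^ N))) \<in> o(\<lambda>N. ln (2 ^ N))" if "\<sigma> > 0" for \<sigma>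
  proof -
    have "P_int X (2 * \<sigma>) (2 ^ N) = P_int X \<sigma> (2 ^ Suc N)" for N :: nat
      by (simp add: P_int_def mult_ac)
    then have "(\<lambda>N. P_int X \<sigma> (2 ^ Suc N) - P_int X \<sigma> (2 ^ N)) \<longlonglongrightarrow> 0"
      using diff[of \<sigma> "2 * \<sigma>"] that by simp
    \<comment> \<open>As ln (2^N) = N ln 2, this is the quotient in the claim; its denominator is
      nonzero from N = 1 on.\<close>
    then have "(\<lambda>N. norm (P_int X \<sigma> (2 ^ N)) / real N / ln 2) \<longlonglongrightarrow> 0 / ln 2"
      by (intro tendsto_divide tendsto_div_of_diff_tendsto_0 tendsto_const) auto
    then show ?thesis
      by (intro smalloI_tendsto) (auto simp: ln_realpow eventually_sequentially intro!: exI[of _ 1])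
  qed
  moreover have "(\<lambda>N::nat. norm (P_int X \<sigma>2 (2 ^ N) - P_int X \<sigma>1 (2 ^ N))) \<in> o(\<lambda>N. 1)"
    if "0 < \<sigma>1" "\<sigma>1 < \<sigma>2" for \<sigma>1 \<sigma>2
    using tendsto_norm_zero[OF diff[OF that]] by (intro smalloI_tendsto) auto
  ultimately show ?thesis by blast
qed

end
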